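(* Let $V$ be Thompson's group acting on the Cantor space $\mathfrak{C}=\{0,1\}^{\mathbb{N}}$. Let $G$ be a finitely generated subgroup of $V$, with $S$ a finite symmetric generating set for $G$. Let $X$ be the $G$-orbit of some $\kappa_0\in\mathfrak{C}$, and let $\Gamma$ be the action graph for $G$ acting on $X$ with respect to $S$ (that is, the Schreier graph with respect to the subgroup $\mathrm{Stab}_G(\kappa_0)$). Then $\Gamma$ is quasi-isometric to a tree.
   Context: Actions are right actions. Thompson's group $V$ is the group of all homeomorphisms $h$ of $\mathfrak{C}=\{0,1\}^{\mathbb{N}}$ that are locally given by prefix replacements: for every $\kappa\in\mathfrak{C}$ there exist a finite prefix $w$ of $\kappa$ and a finite string $u$ over $\{0,1\}$ such that $(w\kappa')h=u\kappa'$ for all $\kappa'\in\mathfrak{C}$. For a group $G$ acting on a set $X$ and a finite symmetric subset $S\subseteq G$, the action graph is the directed graph with vertex set $X$ and a directed edge $(x,x.s)$ for each $x\in X$ and $s\in S$. Connected graphs are viewed as metric spaces with the path metric in which each edge has length $1$ (ignoring directions). *)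

theory Defs
  imports
    "HOL-Analysis.Analysis"
    "HOL-Algebra.Generated_Groups"
    "HOL-Library.Omega_Words_Fun"
    "Graph_Theory.Graph_Theory"
begin

section \<open>Thompson's group \<open>V\<close>\<close>

text \<open>
  The topology on \<open>nat \<Rightarrow> bool\<close> is the product of the discrete topologies;
  \<open>w \<frown> \<kappa>\<close> is the concatenation of a finite and an infinite word.
\<close>

type_synonym cantor = "bool word"

definition prefix_replacing :: "(cantor \<Rightarrow> cantor) \<Rightarrow> bool" where
  "prefix_replacing h \<longleftrightarrow>
     (\<forall>\<kappa>. \<exists>w u. \<kappa> \<in> range (\<lambda>\<kappa>'. w \<frown> \<kappa>') \<and> (\<forall>\<kappa>'. h (w \<frown> \<kappa>') = u \<frown> \<kappa>'))"

text \<open>The group acts on the right, so the product \<open>g h\<close> means: first \<open>g\<close>, then \<open>h\<close>.\<close>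

definition thompson_V :: "(cantor \<Rightarrow> cantor) monoid" where
  "thompson_V =
     \<lparr>carrier = {h. (\<exists>h'. homeomorphism UNIV UNIV h h') \<and> prefix_replacing h},
      mult = (\<lambda>g h. h \<circ> g),
      one = id\<rparr>"

lemma prefix_replacing_comp:
  assumes "prefix_replacing g" "prefix_replacing h"
  shows "prefix_replacing (h \<circ> g)"
  unfolding prefix_replacing_def
proof
  fix \<kappa>
  obtain w u a where wu: "\<kappa> = w \<frown> a" "\<And>b. g (w \<frown> b) = u \<frown> b"
    using assms(1) unfolding prefix_replacing_def by blast
  obtain v z c where vz: "g \<kappa> = v \<frown> c" "\<And>b. h (v \<frown> b) = z \<frown> b"
    using assms(2) unfolding prefix_replacing_def by blast
  have eq: "u \<frown> a = v \<frown> c"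
    using wu vz by simp
  show "\<exists>w u. \<kappa> \<in> range (\<lambda>\<kappa>'. w \<frown> \<kappa>') \<and> (\<forall>\<kappa>'. (h \<circ> g) (w \<frown> \<kappa>') = u \<frown> \<kappa>')"
  proof (cases "length v \<le> length u")
    case True
    define r where "r = drop (length v) u"
    have "take (length v) u = v"
    proof (rule nth_equalityI)
      fix i assume "i < length (take (length v) u)"
      then have i: "i < length v" "i < length u" using True by auto
      then have "u ! i = v ! i"
        using fun_cong[OF eq, of i] by simp
      then show "take (length v) u ! i = v ! i" using i by simp
    qed (use True in simp)
    then have u: "u = v @ r"
      by (metis r_def append_take_drop_id)
    have "(h \<circ> g) (w \<frown> b) = (z @ r) \<frown> b" for b
      using wu(2) vz(2)[of "r \<frown> b"] u by simp
    then show ?thesis using wu(1) by blast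
  next
    case False
    define r where "r = drop (length u) v"
    have "take (length u) v = u"
    proof (rule nth_equalityI)
      fix i assume "i < length (take (length u) v)"
      then have i: "i < length v" "i < length u" using False by auto
      then have "v ! i = u ! i"
        using fun_cong[OF eq, of i] by simp
      then show "take (length u) v ! i = u ! i" using i by simp
    qed (use False in simp)
    then have v: "v = u @ r"
      by (metis r_def append_take_drop_id)
    have "u \<frown> a = u \<frown> (r \<frown> c)"
      unfolding eq v by (rule conc_conc[symmetric])
    then have a: "a = r \<frown> c"
      by (rule iffD1[OF same_concat_eq])
    have "(h \<circ> g) ((w @ r) \<frown> b) = z \<frown> b" for b
      using wu(2)[of "r \<frown> b"] vz(2)[of b] v by simp
    moreover have "\<kappa> = (w @ r) \<frown> c"
      using wu(1) a by simp
    ultimately show ?thesis by blast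
  qed
qed

lemma prefix_replacing_inverse:
  assumes "homeomorphism UNIV UNIV h h'" "prefix_replacing h"
  shows "prefix_replacing h'"
  unfolding prefix_replacing_def
proof
  fix \<kappa>
  obtain w u a where wu: "h' \<kappa> = w \<frown> a" "\<And>b. h (w \<frown> b) = u \<frown> b"
    using assms(2) unfolding prefix_replacing_def by blast
  have "\<kappa> = u \<frown> a"
    using wu assms(1) unfolding homeomorphism_def by (metis UNIV_I)
  moreover have "h' (u \<frown> b) = w \<frown> b" for b
    using wu(2) assms(1) unfolding homeomorphism_def by (metis UNIV_I)
  ultimately show "\<exists>w u. \<kappa> \<in> range (\<lambda>\<kappa>'. w \<frown> \<kappa>') \<and> (\<forall>\<kappa>'. h' (w \<frown> \<kappa>') = u \<frown> \<kappa>')"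
    by blast
qed

lemma group_thompson_V: "group thompson_V"
proof (rule groupI)
  fix g h assume "g \<in> carrier thompson_V" "h \<in> carrier thompson_V"
  then show "g \<otimes>\<^bsub>thompson_V\<^esub> h \<in> carrier thompson_V"
    by (auto simp: thompson_V_def intro: prefix_replacing_comp homeomorphism_compose)
next
  have "prefix_replacing id"
    unfolding prefix_replacing_def by (metis conc_empty id_apply rangeI)
  then show "\<one>\<^bsub>thompson_V\<^esub> \<in> carrier thompson_V"
    by (auto simp: thompson_V_def homeomorphism_def intro!: exI[of _ id])
next
  fix h assume "h \<in> carrier thompson_V"
  then obtain h' where h: "homeomorphism UNIV UNIV h h'" "prefix_replacing h"
    by (auto simp: thompson_V_def)
  then have "h' \<in> carrier thompson_V"
    using prefix_replacing_inverse[OF h] homeomorphism_symD[OF h(1)]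
    by (auto simp: thompson_V_def)
  moreover have "h \<circ> h' = id"
    using h by (auto simp: homeomorphism_def)
  ultimately show "\<exists>g\<in>carrier thompson_V. g \<otimes>\<^bsub>thompson_V\<^esub> h = \<one>\<^bsub>thompson_V\<^esub>"
    by (auto simp: thompson_V_def)
qed (auto simp: thompson_V_def comp_assoc)


section \<open>Graphs as metric spaces\<close>

text \<open>
  A connected graph is represented as a metric space by its vertex set, which sits isometrically
  and with Hausdorff distance at most 1/2 in the geometric realization with unit edges.
  Distances are measured in the underlying undirected graph; parallel edges do not matter.
  In a disconnected graph the infimum of the empty set would give distance 0, but a graph metric
  is only formed for connected graphs.
\<close>

definition path_dist :: "('a, 'b) pre_digraph \<Rightarrow> 'a \<Rightarrow> 'a \<Rightarrow> nat" where
  "path_dist \<Gamma> x y =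
     Inf (length ` {p. pre_digraph.awalk (with_proj (mk_symmetric \<Gamma>)) x p y})"

definition graph_metric :: "('a, 'b) pre_digraph \<Rightarrow> 'a metric" where
  "graph_metric \<Gamma> = metric (verts \<Gamma>, \<lambda>x y. real (path_dist \<Gamma> x y))"

lemma path_dist_le:
  assumes "pre_digraph.awalk (with_proj (mk_symmetric \<Gamma>)) x p y"
  shows "path_dist \<Gamma> x y \<le> length p"
  unfolding path_dist_def using assms by (intro cInf_lower) auto

lemma (in wf_digraph) awalk_mk_symmetric_rev:
  assumes "pre_digraph.awalk (with_proj (mk_symmetric G)) x p y"
  shows "pre_digraph.awalk (with_proj (mk_symmetric G)) y (map prod.swap (rev p)) x"
proof -
  interpret S: pair_wf_digraph "mk_symmetric G" ..
  from assms show ?thesis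
  proof (induction p arbitrary: x)
    case Nil
    then show ?case by (auto simp: S.awalk_Nil_iff)
  next
    case (Cons e p)
    then have e: "e \<in> parcs (mk_symmetric G)" "fst e = x" and p: "S.awalk (snd e) p y"
      by (auto simp: S.awalk_Cons_iff)
    have sw: "prod.swap e \<in> parcs (mk_symmetric G)"
      using e(1) by (auto simp: parcs_mk_symmetric)
    have "S.awalk (snd e) [prod.swap e] x"
      using sw e S.in_arcsD1[of "snd e" "fst e"] S.in_arcsD2[of "snd e" "fst e"]
      by (auto simp: S.awalk_Cons_iff S.awalk_Nil_iff prod.swap_def)
    then show ?case
      using S.awalk_appendI[OF Cons.IH[OF p]] by simp
  qed
qed

lemma (in wf_digraph) path_dist_attained:
  assumes "Digraph_Component.connected G" "x \<in> verts G" "y \<in> verts G"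
  obtains p where "pre_digraph.awalk (with_proj (mk_symmetric G)) x p y"
    "path_dist G x y = length p"
proof -
  interpret S: pair_wf_digraph "mk_symmetric G" ..
  have "x \<rightarrow>\<^sup>*\<^bsub>with_proj (mk_symmetric G)\<^esub> y"
    using assms unfolding Digraph_Component.connected_def strongly_connected_def by simp
  then have "length ` {p. S.awalk x p y} \<noteq> {}"
    by (auto simp: S.reachable_awalk)
  then have "path_dist G x y \<in> length ` {p. S.awalk x p y}"
    unfolding path_dist_def by (rule Inf_nat_def1)
  then show thesis using that by auto
qed

lemma (in wf_digraph) path_dist_commute: "path_dist G x y = path_dist G y x"
proof -
  have "length ` {p. pre_digraph.awalk (with_proj (mk_symmetric G)) x p y}
      \<subseteq> length ` {p. pre_digraph.awalk (with_proj (mk_symmetric G)) y p x}" for x y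
  proof (rule image_subsetI)
    fix p assume "p \<in> {p. pre_digraph.awalk (with_proj (mk_symmetric G)) x p y}"
    then show "length p \<in> length ` {p. pre_digraph.awalk (with_proj (mk_symmetric G)) y p x}"
      using awalk_mk_symmetric_rev[of x p y]
      by (intro image_eqI[of _ _ "map prod.swap (rev p)"]) auto
  qed
  then show ?thesis unfolding path_dist_def by (metis subset_antisym)
qed

lemma (in wf_digraph) Metric_space_path_dist:
  assumes "Digraph_Component.connected G"
  shows "Metric_space (verts G) (\<lambda>x y. real (path_dist G x y))"
proof
  interpret S: pair_wf_digraph "mk_symmetric G" ..
  fix x y assume xy: "x \<in> verts G" "y \<in> verts G"
  show "real (path_dist G x y) = 0 \<longleftrightarrow> x = y"
  proof
    assume "real (path_dist G x y) = 0"
    with path_dist_attained[OF assms xy] obtain p where "S.awalk x p y" "length p = 0"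
      by (metis of_nat_eq_0_iff)
    then show "x = y" by (simp add: S.awalk_Nil_iff)
  next
    assume "x = y"
    then have "S.awalk x [] y" using xy by (simp add: S.awalk_Nil_iff)
    then show "real (path_dist G x y) = 0" using path_dist_le[of G x "[]" y] by simp
  qed
  fix z assume z: "z \<in> verts G"
  obtain p where p: "S.awalk x p y" "path_dist G x y = length p"
    by (rule path_dist_attained[OF assms xy])
  obtain q where q: "S.awalk y q z" "path_dist G y z = length q"
    by (rule path_dist_attained[OF assms xy(2) z])
  have "path_dist G x z \<le> length (p @ q)"
    by (rule path_dist_le[OF S.awalk_appendI[OF p(1) q(1)]])
  then show "real (path_dist G x z) \<le> real (path_dist G x y) + real (path_dist G y z)"
    using p q by simp
qed (simp_all add: path_dist_commute)

lemma (in wf_digraph) graph_metric_connected: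
  assumes "Digraph_Component.connected G"
  shows "mspace (graph_metric G) = verts G"
    and "mdist (graph_metric G) = (\<lambda>x y. real (path_dist G x y))"
proof -
  interpret M: Metric_space "verts G" "\<lambda>x y. real (path_dist G x y)"
    by (rule Metric_space_path_dist[OF assms])
  show "mspace (graph_metric G) = verts G"
    and "mdist (graph_metric G) = (\<lambda>x y. real (path_dist G x y))"
    by (simp_all add: graph_metric_def)
qed

definition quasi_isometric :: "'a metric \<Rightarrow> 'b metric \<Rightarrow> bool" where
  "quasi_isometric m m' \<longleftrightarrow>
     (\<exists>f \<in> mspace m \<rightarrow> mspace m'. \<exists>K \<ge> 1. \<exists>C \<ge> 0.
        (\<forall>x \<in> mspace m. \<forall>y \<in> mspace m.
           mdist m x y / K - C \<le> mdist m' (f x) (f y) \<and>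
           mdist m' (f x) (f y) \<le> K * mdist m x y + C) \<and>
        (\<forall>z \<in> mspace m'. \<exists>x \<in> mspace m. mdist m' (f x) z \<le> C))"

text \<open>
  An undirected tree, encoded as a symmetric digraph without loops and parallel arcs, possibly
  infinite. Each undirected edge gives a directed cycle of length 2, whence the lower bound on the
  length of forbidden cycles. The predicate \<open>tree\<close> of the graph library only excludes directed
  cycles; it would also accept acyclically oriented graphs that are not trees.
\<close>

definition undirected_tree :: "'a pair_pre_digraph \<Rightarrow> bool" where
  "undirected_tree T \<longleftrightarrow>
     pair_bidirected_digraph T \<and> Digraph_Component.connected (with_proj T) \<and>
     \<not> (\<exists>p. pre_digraph.cycle (with_proj T) p \<and> length p \<ge> 3)"


section \<open>Action graphs\<close>

text \<open>Here \<open>act x s\<close> stands for \<open>x.s\<close>.\<close>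

definition action_graph :: "'x set \<Rightarrow> ('x \<Rightarrow> 'g \<Rightarrow> 'x) \<Rightarrow> 'g set \<Rightarrow> ('x, 'x \<times> 'g) pre_digraph" where
  "action_graph X act S =
     \<lparr>verts = X, arcs = X \<times> S, tail = fst, head = (\<lambda>(x, s). act x s)\<rparr>"

definition orbit_graph ::
    "(cantor \<Rightarrow> cantor) set \<Rightarrow> (cantor \<Rightarrow> cantor) set \<Rightarrow> cantor \<Rightarrow>
     (cantor, cantor \<times> (cantor \<Rightarrow> cantor)) pre_digraph" where
  "orbit_graph G S \<kappa>\<^sub>0 = action_graph ((\<lambda>g. g \<kappa>\<^sub>0) ` G) (\<lambda>\<kappa> g. g \<kappa>) S"

lemma wf_orbit_graph:
  assumes "subgroup G thompson_V" "S \<subseteq> G"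
  shows "wf_digraph (orbit_graph G S \<kappa>\<^sub>0)"
proof
  fix e assume "e \<in> arcs (orbit_graph G S \<kappa>\<^sub>0)"
  then obtain g s where e: "e = (g \<kappa>\<^sub>0, s)" "g \<in> G" "s \<in> S"
    by (auto simp: orbit_graph_def action_graph_def)
  then have "s \<circ> g \<in> G"
    using subgroup.m_closed[OF assms(1), of g s] assms(2) by (auto simp: thompson_V_def)
  then show "tail (orbit_graph G S \<kappa>\<^sub>0) e \<in> verts (orbit_graph G S \<kappa>\<^sub>0)"
    and "head (orbit_graph G S \<kappa>\<^sub>0) e \<in> verts (orbit_graph G S \<kappa>\<^sub>0)"
    using e by (auto simp: orbit_graph_def action_graph_def intro: image_eqI[of _ _ "s \<circ> g"])
qed

lemma connected_orbit_graph:
  assumes "subgroup G thompson_V" "S \<subseteq> G" "generate thompson_V S = G"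
  shows "Digraph_Component.connected (orbit_graph G S \<kappa>\<^sub>0)"
proof -
  let ?\<Gamma> = "orbit_graph G S \<kappa>\<^sub>0"
  interpret \<Gamma>: wf_digraph ?\<Gamma>
    by (rule wf_orbit_graph[OF assms(1,2)])
  interpret S: pair_wf_digraph "mk_symmetric ?\<Gamma>" ..
  interpret V: group thompson_V
    by (rule group_thompson_V)
  have [simp]: "verts ?\<Gamma> = (\<lambda>g. g \<kappa>\<^sub>0) ` G"
    by (simp add: orbit_graph_def action_graph_def)
  have closed: "g x \<in> verts ?\<Gamma>" if x: "x \<in> verts ?\<Gamma>" and "g \<in> G" for g x
  proof -
    obtain k where "k \<in> G" "x = k \<kappa>\<^sub>0" using x by auto
    then show ?thesis
      using subgroup.m_closed[OF assms(1), of k g] \<open>g \<in> G\<close>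
      by (auto simp: thompson_V_def intro: image_eqI[of _ _ "g \<circ> k"])
  qed
  have arc: "x \<rightarrow>\<^bsub>with_proj (mk_symmetric ?\<Gamma>)\<^esub> s x \<and> s x \<rightarrow>\<^bsub>with_proj (mk_symmetric ?\<Gamma>)\<^esub> x"
    if "x \<in> verts ?\<Gamma>" "s \<in> S" for x s
    using that by (force simp: parcs_mk_symmetric orbit_graph_def action_graph_def)
  have reach: "x \<rightarrow>\<^sup>*\<^bsub>with_proj (mk_symmetric ?\<Gamma>)\<^esub> g x"
    if "g \<in> generate thompson_V S" "x \<in> verts ?\<Gamma>" for g x
    using that
  proof (induction g arbitrary: x)
    case one
    then show ?case using S.reachable_refl by (simp add: thompson_V_def)
  next
    case (incl h)
    then show ?case using arc S.reachable_adjI by auto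
  next
    case (inv h)
    have hV: "h \<in> carrier thompson_V"
      using inv assms(2) subgroup.subset[OF assms(1)] by auto
    have "inv\<^bsub>thompson_V\<^esub> h \<otimes>\<^bsub>thompson_V\<^esub> h = \<one>\<^bsub>thompson_V\<^esub>"
      using hV by simp
    then have "h (m_inv thompson_V h x) = x"
      by (simp add: thompson_V_def fun_eq_iff)
    moreover have "m_inv thompson_V h x \<in> verts ?\<Gamma>"
      using closed[OF inv(2), of "m_inv thompson_V h"] inv(1) assms(2)
        subgroup.m_inv_closed[OF assms(1)] by blast
    ultimately have "x \<rightarrow>\<^bsub>with_proj (mk_symmetric ?\<Gamma>)\<^esub> m_inv thompson_V h x"
      using arc[of "m_inv thompson_V h x" h] inv(1) by simp
    then show ?case
      by (intro S.reachable_adjI) simp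
  next
    case (eng g h)
    have "g x \<in> verts ?\<Gamma>"
      using closed eng assms(3) by blast
    then have "x \<rightarrow>\<^sup>*\<^bsub>with_proj (mk_symmetric ?\<Gamma>)\<^esub> h (g x)"
      by (rule S.reachable_trans[OF eng.IH(1)[OF eng.prems] eng.IH(2)])
    then show ?case by (simp add: thompson_V_def)
  qed
  have from_base: "\<kappa>\<^sub>0 \<in> verts ?\<Gamma>"
  proof -
    have "id \<in> G"
      using subgroup.one_closed[OF assms(1)] by (simp add: thompson_V_def)
    then have "id \<kappa>\<^sub>0 \<in> (\<lambda>g. g \<kappa>\<^sub>0) ` G"
      by (rule imageI)
    then show ?thesis by simp
  qed
  have "x \<rightarrow>\<^sup>*\<^bsub>with_proj (mk_symmetric ?\<Gamma>)\<^esub> y" if "x \<in> verts ?\<Gamma>" "y \<in> verts ?\<Gamma>" for x y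
  proof -
    have *: "\<kappa>\<^sub>0 \<rightarrow>\<^sup>*\<^bsub>with_proj (mk_symmetric ?\<Gamma>)\<^esub> z" if "z \<in> verts ?\<Gamma>" for z
      using that reach[OF _ from_base] assms(3) by auto
    have "x \<rightarrow>\<^sup>*\<^bsub>with_proj (mk_symmetric ?\<Gamma>)\<^esub> \<kappa>\<^sub>0"
      by (rule symmetric_reachable[OF symmetric_mk_symmetric *[OF that(1)]])
    then show ?thesis
      by (rule S.reachable_trans[OF _ *[OF that(2)]])
  qed
  then show ?thesis
    using from_base unfolding Digraph_Component.connected_def strongly_connected_def by auto
qed

end

theory Submission
  imports Defs
begin

text \<open>
  Every point of the orbit of \<open>\<kappa>\<^sub>0\<close> is \<open>p \<frown> \<kappa>\<close> with \<open>p\<close> a finite word and \<open>\<kappa>\<close> a tail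
  of \<open>\<kappa>\<^sub>0\<close>. A connected graph in which each vertex has at most one parent is a tree up to at most
  one cycle, and joining each infinite word to the word without its first letter gives such a
  graph on the words with a tail in common with \<open>\<kappa>\<^sub>0\<close>. But this graph does not see \<open>G\<close>: points that
  are close in it may be far apart in the action graph. The remedy is to collect the letters in a finite
  word instead of erasing them, and to remember that word only up to what \<open>G\<close> can do.

  Call a word \<open>p\<close> replaceable by \<open>q\<close> if a single \<open>g \<in> G\<close> maps \<open>p \<frown> \<kappa>\<close> to \<open>q \<frown> \<kappa>\<close> for all
  \<open>\<kappa>\<close>. This is an equivalence relation that is compatible with appending letters on the right.
  Two facts connect it with the metric. If \<open>p\<close> is replaceable by \<open>q\<close>, then \<open>p \<frown> \<kappa>\<close> and
  \<open>q \<frown> \<kappa>\<close> are joined by a path whose length does not depend on \<open>\<kappa>\<close>, hence a bounded one if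
  \<open>p\<close> and \<open>q\<close> have bounded length (\<open>replaceable_path_dist_bounded\<close>). Conversely, the Cantor space
  is compact, so there is a bound \<open>M\<close> such that each step of the action graph replaces a word by
  another one, both of length at most \<open>M\<close> (\<open>prefix_replacing_bounded\<close>).

  The vertices of the new graph are the pairs \<open>(p, \<kappa>)\<close> with \<open>p \<frown> \<kappa>\<close> in the orbit and \<open>p\<close> the
  chosen representative, of length at most \<open>M\<close>, of its class. The parent of \<open>(p, x\<kappa>)\<close> is
  \<open>(q, \<kappa>)\<close>, where \<open>q\<close> represents the class of \<open>px\<close>; if that class has no word of length at
  most \<open>M\<close>, the vertex is its own parent. Each orbit point \<open>x\<close> is sent to the pair of the
  representative of the empty word and \<open>x\<close>, and each vertex \<open>(p, \<kappa>)\<close> is sent back to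
  \<open>p \<frown> \<kappa>\<close>. A step of the action graph turns \<open>w \<frown> \<kappa>\<close> into \<open>u \<frown> \<kappa>\<close> with \<open>w\<close>
  replaceable by \<open>u\<close>, so that after \<open>|w|\<close> and \<open>|u|\<close> parent steps the images of the two points
  coincide (\<open>funpow_parent\<close>). A parent step in turn moves the corresponding orbit point by a bounded
  amount. The two maps are therefore Lipschitz, and they are inverse to each other up to bounded error,
  so they are quasi-isometries.

  The action graph is connected, hence any two vertices have a common iterated parent, and the new
  graph is connected with at most one cycle. A cycle can occur only for an eventually periodic
  \<open>\<kappa>\<^sub>0\<close>; removing one edge of it leaves a tree and changes distances by a bounded factor only
  (\<open>cut_periodic_orbit\<close>).
\<close>

section \<open>Path metrics and coarse equivalences\<close>

text \<open>
  Induction along a shortest undirected path; \<open>P n x y\<close> may track the number \<open>n\<close> of edges or ignore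
  it. It serves both for Lipschitz estimates and for showing that an equivalence that holds along edges
  holds between all vertices.
\<close>

lemma path_dist_induct:
  assumes wf: "wf_digraph \<Gamma>" and con: "Digraph_Component.connected \<Gamma>"
    and x: "x \<in> verts \<Gamma>" and y: "y \<in> verts \<Gamma>"
    and refl: "\<And>v. v \<in> verts \<Gamma> \<Longrightarrow> P 0 v v"
    and step: "\<And>n u v w e. \<lbrakk>P n v w; u \<in> verts \<Gamma>; v \<in> verts \<Gamma>; w \<in> verts \<Gamma>; e \<in> arcs \<Gamma>;
      (tail \<Gamma> e, head \<Gamma> e) = (u, v) \<or> (tail \<Gamma> e, head \<Gamma> e) = (v, u)\<rbrakk> \<Longrightarrow> P (Suc n) u w"
  shows "P (path_dist \<Gamma> x y) x y"
proof -
  interpret wf_digraph \<Gamma> by (rule wf)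
  interpret S: pair_wf_digraph "mk_symmetric \<Gamma>" ..
  obtain p where p: "S.awalk x p y" "path_dist \<Gamma> x y = length p"
    by (rule path_dist_attained[OF con x y])
  have "P (length p) x y" using p(1) x
  proof (induction p arbitrary: x)
    case Nil
    then show ?case using refl by (auto simp: S.awalk_Nil_iff)
  next
    case (Cons a p)
    then have a: "a \<in> parcs (mk_symmetric \<Gamma>)" "fst a = x" and w: "S.awalk (snd a) p y"
      by (auto simp: S.awalk_Cons_iff)
    have v: "snd a \<in> verts \<Gamma>" using S.arc_snd_in_verts[OF a(1)] by simp
    obtain e where e: "e \<in> arcs \<Gamma>"
      "(tail \<Gamma> e, head \<Gamma> e) = (x, snd a) \<or> (tail \<Gamma> e, head \<Gamma> e) = (snd a, x)"
      using a by (cases a) (auto simp: parcs_mk_symmetric)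
    show ?case
      using step[OF Cons.IH[OF w v] Cons.prems(2) v y e] by simp
  qed
  then show ?thesis using p(2) by simp
qed

lemma path_dist_arc_le:
  assumes "wf_digraph \<Gamma>" "e \<in> arcs \<Gamma>"
  shows "path_dist \<Gamma> (tail \<Gamma> e) (head \<Gamma> e) \<le> 1"
proof -
  interpret wf_digraph \<Gamma> by fact
  interpret S: pair_wf_digraph "mk_symmetric \<Gamma>" ..
  have "S.awalk (tail \<Gamma> e) [(tail \<Gamma> e, head \<Gamma> e)] (head \<Gamma> e)"
    using assms(2) by (auto simp: S.awalk_Cons_iff S.awalk_Nil_iff parcs_mk_symmetric)
  from path_dist_le[OF this] show ?thesis by simp
qed

lemma path_dist_self:
  assumes "v \<in> verts \<Gamma>"
  shows "path_dist \<Gamma> v v = 0"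
proof -
  have "pre_digraph.awalk (with_proj (mk_symmetric \<Gamma>)) v [] v"
    using assms by (simp add: pre_digraph.awalk_def pre_digraph.cas.simps)
  from path_dist_le[OF this] show ?thesis by simp
qed

lemma path_dist_triangle:
  assumes "wf_digraph \<Gamma>" "Digraph_Component.connected \<Gamma>"
    "x \<in> verts \<Gamma>" "y \<in> verts \<Gamma>" "z \<in> verts \<Gamma>"
  shows "path_dist \<Gamma> x z \<le> path_dist \<Gamma> x y + path_dist \<Gamma> y z"
proof -
  interpret Metric_space "verts \<Gamma>" "\<lambda>x y. real (path_dist \<Gamma> x y)"
    by (rule wf_digraph.Metric_space_path_dist[OF assms(1,2)])
  show ?thesis using triangle[OF assms(3-5)] by linarith
qed

lemma path_dist_lipschitz:
  assumes \<Gamma>: "wf_digraph \<Gamma>" "Digraph_Component.connected \<Gamma>"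
    and \<Delta>: "wf_digraph \<Delta>" "Digraph_Component.connected \<Delta>"
    and F: "F \<in> verts \<Gamma> \<rightarrow> verts \<Delta>"
    and arc: "\<And>e. e \<in> arcs \<Gamma> \<Longrightarrow> path_dist \<Delta> (F (tail \<Gamma> e)) (F (head \<Gamma> e)) \<le> k"
    and xy: "x \<in> verts \<Gamma>" "y \<in> verts \<Gamma>"
  shows "path_dist \<Delta> (F x) (F y) \<le> k * path_dist \<Gamma> x y"
proof (rule path_dist_induct[OF \<Gamma> xy, where P = "\<lambda>n x y. path_dist \<Delta> (F x) (F y) \<le> k * n"])
  fix v assume "v \<in> verts \<Gamma>"
  then show "path_dist \<Delta> (F v) (F v) \<le> k * 0"
    using F path_dist_self[of "F v" \<Delta>] by auto
next
  fix n u v w e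
  assume IH: "path_dist \<Delta> (F v) (F w) \<le> k * n"
    and V: "u \<in> verts \<Gamma>" "v \<in> verts \<Gamma>" "w \<in> verts \<Gamma>" and e: "e \<in> arcs \<Gamma>"
    "(tail \<Gamma> e, head \<Gamma> e) = (u, v) \<or> (tail \<Gamma> e, head \<Gamma> e) = (v, u)"
  have "path_dist \<Delta> (F u) (F v) \<le> k"
    using arc[OF e(1)] e(2) wf_digraph.path_dist_commute[OF \<Delta>(1)] by auto
  moreover have "path_dist \<Delta> (F u) (F w) \<le> path_dist \<Delta> (F u) (F v) + path_dist \<Delta> (F v) (F w)"
    using path_dist_triangle[OF \<Delta>] F V by auto
  ultimately show "path_dist \<Delta> (F u) (F w) \<le> k * Suc n"
    using IH by simp
qed

text \<open>
  The lower estimate for \<open>f\<close> is the Lipschitz estimate for \<open>g\<close>, up to the bounded error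
  between \<open>g (f x)\<close> and \<open>x\<close>.
\<close>

lemma quasi_isometric_if_coarse_inverses:
  assumes \<Gamma>: "wf_digraph \<Gamma>" "Digraph_Component.connected \<Gamma>"
    and \<Delta>: "wf_digraph \<Delta>" "Digraph_Component.connected \<Delta>"
    and f: "f \<in> verts \<Gamma> \<rightarrow> verts \<Delta>"
    and g: "g \<in> verts \<Delta> \<rightarrow> verts \<Gamma>"
    and f_arc: "\<And>e. e \<in> arcs \<Gamma> \<Longrightarrow> path_dist \<Delta> (f (tail \<Gamma> e)) (f (head \<Gamma> e)) \<le> k"
    and g_arc: "\<And>e. e \<in> arcs \<Delta> \<Longrightarrow> path_dist \<Gamma> (g (tail \<Delta> e)) (g (head \<Delta> e)) \<le> k"
    and gf: "\<And>x. x \<in> verts \<Gamma> \<Longrightarrow> path_dist \<Gamma> (g (f x)) x \<le> k"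
    and fg: "\<And>v. v \<in> verts \<Delta> \<Longrightarrow> path_dist \<Delta> (f (g v)) v \<le> k"
  shows "quasi_isometric (graph_metric \<Gamma>) (graph_metric \<Delta>)"
proof -
  note m\<Gamma> = wf_digraph.graph_metric_connected[OF \<Gamma>]
  note m\<Delta> = wf_digraph.graph_metric_connected[OF \<Delta>]
  let ?K = "real k + 1" and ?C = "2 * real k"
  have lower: "real (path_dist \<Gamma> x y) / ?K - ?C \<le> real (path_dist \<Delta> (f x) (f y))"
    if xy: "x \<in> verts \<Gamma>" "y \<in> verts \<Gamma>" for x y
  proof -
    have fxy: "f x \<in> verts \<Delta>" "f y \<in> verts \<Delta>" and gfxy: "g (f x) \<in> verts \<Gamma>" "g (f y) \<in> verts \<Gamma>"
      using xy f g by auto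
    have "path_dist \<Gamma> x y \<le> path_dist \<Gamma> x (g (f x)) + path_dist \<Gamma> (g (f x)) y"
      by (rule path_dist_triangle[OF \<Gamma> xy(1) gfxy(1) xy(2)])
    also have "\<dots> \<le> path_dist \<Gamma> x (g (f x)) + (path_dist \<Gamma> (g (f x)) (g (f y)) + path_dist \<Gamma> (g (f y)) y)"
      using path_dist_triangle[OF \<Gamma> gfxy xy(2)] by simp
    also have "\<dots> \<le> k + (k * path_dist \<Delta> (f x) (f y) + k)"
    proof (intro add_mono)
      show "path_dist \<Gamma> x (g (f x)) \<le> k"
        using gf[OF xy(1)] wf_digraph.path_dist_commute[OF \<Gamma>(1)] by simp
      show "path_dist \<Gamma> (g (f x)) (g (f y)) \<le> k * path_dist \<Delta> (f x) (f y)"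
        by (rule path_dist_lipschitz[OF \<Delta> \<Gamma> g g_arc fxy])
    qed (rule gf[OF xy(2)])
    finally have "real (path_dist \<Gamma> x y) \<le> real (k + (k * path_dist \<Delta> (f x) (f y) + k))"
      by (rule of_nat_mono)
    also have "\<dots> \<le> ?K * (real (path_dist \<Delta> (f x) (f y)) + ?C)"
      by (simp add: algebra_simps)
    finally show ?thesis
      by (simp add: field_simps)
  qed
  have upper: "real (path_dist \<Delta> (f x) (f y)) \<le> ?K * real (path_dist \<Gamma> x y) + ?C"
    if xy: "x \<in> verts \<Gamma>" "y \<in> verts \<Gamma>" for x y
  proof -
    have "real (path_dist \<Delta> (f x) (f y)) \<le> real (k * path_dist \<Gamma> x y)"
      by (rule of_nat_mono[OF path_dist_lipschitz[OF \<Gamma> \<Delta> f f_arc xy]])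
    also have "\<dots> \<le> ?K * real (path_dist \<Gamma> x y) + ?C"
      by (simp add: algebra_simps)
    finally show ?thesis .
  qed
  have dense: "\<exists>x\<in>verts \<Gamma>. real (path_dist \<Delta> (f x) v) \<le> ?C" if "v \<in> verts \<Delta>" for v
    using fg[OF that] g that by (intro bexI[of _ "g v"]) auto
  show ?thesis
    unfolding quasi_isometric_def m\<Gamma> m\<Delta>
    using f lower upper dense by (intro bexI[of _ f] exI[of _ ?K] exI[of _ ?C] conjI) auto
qed


section \<open>Trees from parent functions\<close>

text \<open>
  For a function \<open>\<phi>\<close> from a nonempty \<open>V\<close> to itself, this is connectedness of the graph that joins
  each vertex to its image.
\<close>

definition merging :: "'a set \<Rightarrow> ('a \<Rightarrow> 'a) \<Rightarrow> bool" where
  "merging V \<phi> \<longleftrightarrow> (\<forall>u\<in>V. \<forall>v\<in>V. \<exists>m n. (\<phi> ^^ m) u = (\<phi> ^^ n) v)"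

definition parent_graph :: "'a set \<Rightarrow> ('a \<Rightarrow> 'a) \<Rightarrow> 'a pair_pre_digraph" where
  "parent_graph V \<phi> =
     \<lparr>pverts = V, parcs = {(u, v). u \<in> V \<and> v \<in> V \<and> u \<noteq> v \<and> (v = \<phi> u \<or> u = \<phi> v)}\<rparr>"

lemma pverts_parent_graph [simp]: "pverts (parent_graph V \<phi>) = V"
  by (simp add: parent_graph_def)

lemma pair_bidirected_parent_graph: "pair_bidirected_digraph (parent_graph V \<phi>)"
  by unfold_locales (auto simp: parent_graph_def symmetric_def intro!: symI)

lemma wf_parent_graph: "wf_digraph (with_proj (parent_graph V \<phi>))"
  by unfold_locales (auto simp: parent_graph_def)

lemma funpow_closed:
  assumes "\<phi> \<in> V \<rightarrow> V" "v \<in> V"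
  shows "(\<phi> ^^ n) v \<in> V"
  using assms by (induction n) auto

lemma connected_parent_graph:
  assumes "V \<noteq> {}" "\<phi> \<in> V \<rightarrow> V" "merging V \<phi>"
  shows "Digraph_Component.connected (with_proj (parent_graph V \<phi>))"
proof -
  let ?T = "with_proj (parent_graph V \<phi>)"
  interpret T: wf_digraph ?T by (rule wf_parent_graph)
  interpret S: pair_wf_digraph "mk_symmetric ?T" ..
  have up: "u \<rightarrow>\<^sup>*\<^bsub>with_proj (mk_symmetric ?T)\<^esub> (\<phi> ^^ n) u" if "u \<in> V" for u n
  proof (induction n)
    case 0
    have "u \<in> verts ?T" using that by (simp add: parent_graph_def)
    then show ?case by simp
  next
    case (Suc n)
    let ?v = "(\<phi> ^^ n) u"
    have "?v \<in> V" "\<phi> ?v \<in> V" using funpow_closed[OF assms(2) that] assms(2) by auto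
    then have v: "?v \<in> verts ?T" "\<phi> ?v \<noteq> ?v \<Longrightarrow> (?v, \<phi> ?v) \<in> arcs ?T"
      by (auto simp: parent_graph_def)
    have "?v \<rightarrow>\<^sup>*\<^bsub>with_proj (mk_symmetric ?T)\<^esub> \<phi> ?v"
    proof (cases "\<phi> ?v = ?v")
      case True
      then show ?thesis using v(1) by simp
    next
      case False
      then have "(?v, \<phi> ?v) \<in> parcs (mk_symmetric ?T)"
        using v(2) by (force simp: parcs_mk_symmetric)
      then show ?thesis by (intro S.reachable_adjI) simp
    qed
    then show ?case using S.reachable_trans[OF Suc] by simp
  qed
  have "u \<rightarrow>\<^sup>*\<^bsub>with_proj (mk_symmetric ?T)\<^esub> v" if uv: "u \<in> V" "v \<in> V" for u v
  proof -
    obtain m n where "(\<phi> ^^ m) u = (\<phi> ^^ n) v"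
      using assms(3) uv unfolding merging_def by blast
    then show ?thesis
      using S.reachable_trans[OF up[OF uv(1), of m]]
        symmetric_reachable[OF symmetric_mk_symmetric up[OF uv(2), of n]] by simp
  qed
  then show ?thesis
    using assms(1) unfolding Digraph_Component.connected_def strongly_connected_def
    by (auto simp: parent_graph_def)
qed

lemma pcas_nth_Suc:
  assumes "pcas u p v" "Suc i < length p"
  shows "snd (p ! i) = fst (p ! Suc i)"
  using assms
proof (induction p arbitrary: u i)
  case (Cons a p)
  then show ?case by (cases i; cases p) auto
qed simp

lemma pcas_last:
  assumes "pcas u p v" "p \<noteq> []"
  shows "snd (last p) = v \<and> fst (hd p) = u"
  using assms by (induction p arbitrary: u) auto

lemma tl_pawalk_verts:
  assumes "pcas u p v"
  shows "tl (pawalk_verts u p) = map snd p"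
  using assms
proof (induction p arbitrary: u)
  case (Cons a p)
  then show ?case by (cases p) auto
qed simp

text \<open>
  Each edge of a cycle is traversed either from a vertex to its parent (upwards) or the other way
  (downwards). After a downward step, an upward step would return to the vertex just left, as a vertex
  has only one parent; so a downward step is followed by downward steps only. Hence a cycle goes upwards
  all the way or downwards all the way, and its vertices are periodic for \<open>\<phi>\<close>. They would be fixed,
  whereas the ends of an edge differ.
\<close>

lemma undirected_tree_parent_graph:
  assumes "V \<noteq> {}" "\<phi> \<in> V \<rightarrow> V" "merging V \<phi>"
    and periodic: "\<And>v n. \<lbrakk>v \<in> V; n > 0; (\<phi> ^^ n) v = v\<rbrakk> \<Longrightarrow> \<phi> v = v"
  shows "undirected_tree (parent_graph V \<phi>)"
  unfolding undirected_tree_def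
proof (intro conjI notI)
  show "pair_bidirected_digraph (parent_graph V \<phi>)"
    by (rule pair_bidirected_parent_graph)
  show "Digraph_Component.connected (with_proj (parent_graph V \<phi>))"
    by (rule connected_parent_graph[OF assms(1-3)])
  assume "\<exists>p. pre_digraph.cycle (with_proj (parent_graph V \<phi>)) p \<and> length p \<ge> 3"
  then obtain u p where p: "set p \<subseteq> parcs (parent_graph V \<phi>)" "pcas u p u"
      "distinct (tl (pawalk_verts u p))" and len: "length p \<ge> 3"
    unfolding pre_digraph.cycle_def pre_digraph.awalk_def cas_with_proj_eq awalk_verts_with_proj_eq
    by auto
  define l where "l = length p"
  have l: "l \<ge> 3" and [simp]: "l > 0" "p \<noteq> []" using len by (auto simp: l_def)
  \<comment> \<open>The cycle as a periodic sequence of vertices, so that indices need not be wrapped around.\<close>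
  define v where "v i = snd (p ! (i mod l))" for i
  have next_arc: "v i = fst (p ! (Suc i mod l))" for i
  proof (cases "Suc (i mod l) = l")
    case True
    then have "i mod l = l - 1" "Suc i mod l = 0" by (auto simp: mod_Suc)
    then show ?thesis
      using pcas_last[OF p(2)] by (simp add: v_def l_def last_conv_nth hd_conv_nth)
  next
    case False
    then have "Suc i mod l = Suc (i mod l)" by (simp add: mod_Suc)
    moreover have "Suc (i mod l) < length p"
      using False mod_less_divisor[OF \<open>l > 0\<close>, of i] unfolding l_def by linarith
    ultimately show ?thesis using pcas_nth_Suc[OF p(2)] by (simp add: v_def)
  qed
  have arc: "(v i, v (Suc i)) \<in> parcs (parent_graph V \<phi>)" for i
  proof -
    have "p ! (Suc i mod l) \<in> set p" by (simp add: l_def)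
    then show ?thesis using p(1) next_arc[of i] by (auto simp: v_def)
  qed
  have inV: "v i \<in> V" and neq: "v i \<noteq> v (Suc i)"
    and dir: "v (Suc i) = \<phi> (v i) \<or> v i = \<phi> (v (Suc i))" for i
    using arc[of i] by (auto simp: parent_graph_def)
  have v_inj: "i mod l = j mod l" if "v i = v j" for i j
  proof -
    have "distinct (map snd p)" using p(3) tl_pawalk_verts[OF p(2)] by simp
    moreover have "map snd p ! (i mod l) = map snd p ! (j mod l)"
      using that by (simp add: v_def l_def)
    ultimately show ?thesis
      by (subst (asm) nth_eq_iff_index_eq) (simp_all add: l_def)
  qed
  have v_period: "v (i + l) = v i" for i by (simp add: v_def)
  show False
  proof (cases "\<exists>i. v i = \<phi> (v (Suc i))")
    case True
    then obtain i where i: "v i = \<phi> (v (Suc i))" by blast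
    have down: "v (i + j) = \<phi> (v (Suc (i + j)))" for j
    proof (induction j)
      case (Suc j)
      show ?case
      proof (rule ccontr)
        assume "v (i + Suc j) \<noteq> \<phi> (v (Suc (i + Suc j)))"
        \<comment> \<open>An upward step after a downward one goes back to the vertex just left,
          but the cycle has at least three vertices.\<close>
        then have "v (i + j + 2) = v (i + j)" using dir[of "i + Suc j"] Suc by auto
        then have "(i + j + 2) mod l = (i + j) mod l" by (rule v_inj)
        then have "l dvd 2" 
            using mod_eq_dvd_iff_nat[of "i + j" "i + j + 2" l] by simp
        then show False using l by (auto dest: dvd_imp_le)
      qed
    qed (use i in simp)
    have iter: "v (i + j) = (\<phi> ^^ n) (v (i + j + n))" for j n
    proof (induction n)
      case (Suc n)
      then show ?case using down[of "j + n"] by (simp add: add.assoc funpow_swap1)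
    qed simp
    have fixed: "\<phi> (v (i + j)) = v (i + j)" for j
    proof -
      have "v (i + j) = (\<phi> ^^ l) (v (i + j))"
        using iter[of j l] unfolding v_period .
      then show ?thesis using periodic[OF inV \<open>l > 0\<close>] by metis
    qed
    have "\<phi> (v (Suc i)) = v (Suc i)" using fixed[of 1] by simp
    then show False using i neq[of i] by metis
  next
    case False
    then have up: "v (Suc i) = \<phi> (v i)" for i using dir by blast
    have "v n = (\<phi> ^^ n) (v 0)" for n
      by (induction n) (simp_all add: up)
    from this[of l] have "v 0 = (\<phi> ^^ l) (v 0)"
      using v_period[of 0] unfolding add_0 by metis
    then have "\<phi> (v 0) = v 0"
      using periodic[OF inV \<open>l > 0\<close>] by metis
    then show False using up[of 0] neq[of 0] by metis
  qed
qed

lemma path_dist_parent_graph_funpow: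
  assumes "\<phi> \<in> V \<rightarrow> V" "merging V \<phi>" "v \<in> V"
  shows "path_dist (with_proj (parent_graph V \<phi>)) v ((\<phi> ^^ n) v) \<le> n"
proof (induction n)
  case 0
  then show ?case using assms(3) by (simp add: path_dist_self parent_graph_def)
next
  case (Suc n)
  let ?T = "with_proj (parent_graph V \<phi>)" and ?w = "(\<phi> ^^ n) v"
  have w: "?w \<in> V" "\<phi> ?w \<in> V" using funpow_closed[OF assms(1,3)] assms(1) by auto
  have "path_dist ?T ?w (\<phi> ?w) \<le> 1"
  proof (cases "\<phi> ?w = ?w")
    case True
    then show ?thesis using w by (simp add: path_dist_self parent_graph_def)
  next
    case False
    then have "(?w, \<phi> ?w) \<in> arcs ?T" using w by (auto simp: parent_graph_def)
    from path_dist_arc_le[OF wf_parent_graph this] show ?thesis by simp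
  qed
  moreover have "path_dist ?T v (\<phi> ?w) \<le> path_dist ?T v ?w + path_dist ?T ?w (\<phi> ?w)"
    using connected_parent_graph[OF _ assms(1,2)] assms(3) w
    by (intro path_dist_triangle wf_parent_graph) (auto simp: parent_graph_def)
  ultimately show ?case using Suc by simp
qed

lemma path_dist_parent_graph_merge:
  assumes \<phi>: "\<phi> \<in> V \<rightarrow> V" "merging V \<phi>" and uv: "u \<in> V" "v \<in> V"
    and eq: "(\<phi> ^^ m) u = (\<phi> ^^ n) v"
  shows "path_dist (with_proj (parent_graph V \<phi>)) u v \<le> m + n"
proof -
  let ?T = "with_proj (parent_graph V \<phi>)" and ?w = "(\<phi> ^^ m) u"
  have "path_dist ?T u v \<le> path_dist ?T u ?w + path_dist ?T ?w v"
    using connected_parent_graph[OF _ \<phi>] uv funpow_closed[OF \<phi>(1) uv(1)]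
    by (intro path_dist_triangle wf_parent_graph) (auto simp: parent_graph_def)
  moreover have "path_dist ?T u ?w \<le> m"
    by (rule path_dist_parent_graph_funpow[OF \<phi> uv(1)])
  moreover have "path_dist ?T ?w v \<le> n"
    using path_dist_parent_graph_funpow[OF \<phi> uv(2), of n] eq
      wf_digraph.path_dist_commute[OF wf_parent_graph] by metis
  ultimately show ?thesis by simp
qed

text \<open>
  If \<open>c\<close> is a periodic point of \<open>\<phi>\<close>, then all orbits reach \<open>c\<close>, since they merge. Turning \<open>c\<close>
  into a root removes at most one edge and leaves no periodic points besides \<open>c\<close>. The edge that is
  lost can be replaced by the remaining part of the cycle, whose length is
  independent of the vertices whose distance is measured.
\<close>

lemma cut_periodic_orbit:
  assumes \<phi>: "\<phi> \<in> V \<rightarrow> V" and merge: "merging V \<phi>"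
  obtains \<psi> C where "\<psi> \<in> V \<rightarrow> V" "merging V \<psi>"
    "\<And>v n. \<lbrakk>v \<in> V; n > 0; (\<psi> ^^ n) v = v\<rbrakk> \<Longrightarrow> \<psi> v = v"
    "\<And>v. v \<in> V \<Longrightarrow> \<psi> v = v \<or> \<psi> v = \<phi> v"
    "\<And>v. v \<in> V \<Longrightarrow> \<exists>m n. m + n \<le> C \<and> (\<psi> ^^ m) v = (\<psi> ^^ n) (\<phi> v)"
proof (cases "\<exists>c\<in>V. \<exists>k>0. (\<phi> ^^ k) c = c")
  case False
  have "\<exists>m n. m + n \<le> 1 \<and> (\<phi> ^^ m) v = (\<phi> ^^ n) (\<phi> v)" for v
    by (intro exI[of _ 1] exI[of _ 0]) simp
  then show ?thesis using that[of \<phi> 1] \<phi> merge False by blast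
next
  case True
  then obtain c k where c: "c \<in> V" "k > 0" "(\<phi> ^^ k) c = c" by blast
  define \<psi> where "\<psi> = \<phi>(c := c)"
  have \<psi>V: "\<psi> \<in> V \<rightarrow> V" using \<phi> c(1) by (auto simp: \<psi>_def)
  \<comment> \<open>Up to the first visit to \<open>c\<close>, both functions have the same orbits.\<close>
  have hit: "\<exists>m'\<le>m. (\<psi> ^^ m') v = c" if "(\<phi> ^^ m) v = c" for m v
    using that
  proof (induction m arbitrary: v)
    case (Suc m)
    show ?case
    proof (cases "v = c")
      case True
      then show ?thesis by (intro exI[of _ 0]) simp
    next
      case False
      obtain m' where "m' \<le> m" "(\<psi> ^^ m') (\<phi> v) = c"
        using Suc.IH[of "\<phi> v"] Suc.prems by (auto simp: funpow_swap1)
      moreover have "\<psi> v = \<phi> v" using False by (simp add: \<psi>_def)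
      ultimately show ?thesis
        by (intro exI[of _ "Suc m'"]) (simp add: funpow_Suc_right del: funpow.simps)
    qed
  qed simp
  have "\<psi> c = c" by (simp add: \<psi>_def)
  then have stay: "(\<psi> ^^ j) c = c" for j
    by (induction j) simp_all
  have reach: "\<exists>m. (\<psi> ^^ m) v = c" if v: "v \<in> V" for v
  proof -
    obtain m n where mn: "(\<phi> ^^ m) v = (\<phi> ^^ n) c"
      using merge v c(1) unfolding merging_def by blast
    have per: "(\<phi> ^^ (k * i)) c = c" for i
    proof (induction i)
      case (Suc i)
      then show ?case unfolding mult_Suc_right funpow_add comp_apply using c(3) by metis
    qed simp
    have "(\<phi> ^^ (k * n - n + m)) v = (\<phi> ^^ (k * n - n + n)) c"
      unfolding funpow_add comp_apply mn ..
    also have "k * n - n + n = k * n" using c(2) by simp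
    finally have "(\<phi> ^^ (k * n - n + m)) v = c" unfolding per .
    then show ?thesis using hit by blast
  qed
  have merge_\<psi>: "merging V \<psi>"
    unfolding merging_def using reach by metis
  have per_\<psi>: "\<psi> v = v" if v: "v \<in> V" "n > 0" "(\<psi> ^^ n) v = v" for v n
  proof -
    obtain m where m: "(\<psi> ^^ m) v = c" using reach[OF v(1)] by blast
    have per: "(\<psi> ^^ (n * i)) v = v" for i
    proof (induction i)
      case (Suc i)
      then show ?case unfolding mult_Suc_right funpow_add comp_apply using v(3) by metis
    qed simp
    have "n * m = n * m - m + m" using v(2) by simp
    then have "v = (\<psi> ^^ (n * m - m + m)) v" using per[of m] by metis
    also have "\<dots> = c" unfolding funpow_add comp_apply m by (rule stay)
    finally show ?thesis by (simp add: \<psi>_def)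
  qed
  have close: "\<exists>m n. m + n \<le> k \<and> (\<psi> ^^ m) v = (\<psi> ^^ n) (\<phi> v)" for v
  proof (cases "v = c")
    case True
    have "(\<phi> ^^ (k - 1)) (\<phi> c) = (\<phi> ^^ Suc (k - 1)) c"
      by (simp only: funpow_Suc_right comp_apply)
    then have "(\<phi> ^^ (k - 1)) (\<phi> c) = c" using c(2,3) by simp
    then obtain n where "n \<le> k - 1" "(\<psi> ^^ n) (\<phi> c) = c" using hit by blast
    then show ?thesis using True by (intro exI[of _ 0] exI[of _ n]) simp
  next
    case False
    then show ?thesis using c(2) by (intro exI[of _ 1] exI[of _ 0]) (simp add: \<psi>_def)
  qed
  have "\<psi> v = v \<or> \<psi> v = \<phi> v" for v by (simp add: \<psi>_def)
  then show ?thesis using that[of \<psi> k] \<psi>V merge_\<psi> per_\<psi> close by blast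
qed

lemma merging_trans:
  fixes \<phi> :: "'a \<Rightarrow> 'a"
  assumes "(\<phi> ^^ m) u = (\<phi> ^^ n) v" "(\<phi> ^^ m') v = (\<phi> ^^ n') w"
  shows "(\<phi> ^^ (m' + m)) u = (\<phi> ^^ (n + n')) w"
proof -
  have "(\<phi> ^^ (m' + m)) u = (\<phi> ^^ (m' + n)) v"
    unfolding funpow_add comp_apply assms(1) ..
  also have "\<dots> = (\<phi> ^^ (n + m')) v"
    by (simp only: add.commute)
  also have "\<dots> = (\<phi> ^^ (n + n')) w"
    unfolding funpow_add comp_apply assms(2) ..
  finally show ?thesis .
qed

text \<open>
  A connected graph is quasi-isometric to a tree as soon as it has a coarse inverse pair of maps to and
  from the functional graph of some \<open>\<phi>\<close>. That the orbits of \<open>\<phi>\<close> merge is a consequence: they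
  merge along each edge of \<open>\<Gamma>\<close>, and \<open>\<Gamma>\<close> is connected.
\<close>

lemma quasi_isometric_parent_graph:
  assumes \<Gamma>: "wf_digraph \<Gamma>" "Digraph_Component.connected \<Gamma>"
    and \<phi>: "\<phi> \<in> V \<rightarrow> V"
    and f: "f \<in> verts \<Gamma> \<rightarrow> V"
    and g: "g \<in> V \<rightarrow> verts \<Gamma>"
    and f_arc: "\<And>e. e \<in> arcs \<Gamma> \<Longrightarrow>
      \<exists>m\<le>k. \<exists>n\<le>k. (\<phi> ^^ m) (f (tail \<Gamma> e)) = (\<phi> ^^ n) (f (head \<Gamma> e))"
    and g_arc: "\<And>v. v \<in> V \<Longrightarrow> path_dist \<Gamma> (g v) (g (\<phi> v)) \<le> k"
    and gf: "\<And>x. x \<in> verts \<Gamma> \<Longrightarrow> path_dist \<Gamma> (g (f x)) x \<le> k"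
    and fg: "\<And>v. v \<in> V \<Longrightarrow> \<exists>m\<le>k. (\<phi> ^^ m) (f (g v)) = v"
  obtains \<psi> where "undirected_tree (parent_graph V \<psi>)"
    "quasi_isometric (graph_metric \<Gamma>) (graph_metric (with_proj (parent_graph V \<psi>)))"
proof -
  have merge: "merging V \<phi>"
    unfolding merging_def
  proof (intro ballI)
    fix u v assume uv: "u \<in> V" "v \<in> V"
    then have "g u \<in> verts \<Gamma>" "g v \<in> verts \<Gamma>" using g by auto
    then have "\<exists>m n. (\<phi> ^^ m) (f (g u)) = (\<phi> ^^ n) (f (g v))"
    proof (rule path_dist_induct[OF \<Gamma>, where P = "\<lambda>_ x y. \<exists>m n. (\<phi> ^^ m) (f x) = (\<phi> ^^ n) (f y)"])
      fix x y z e
      assume "\<exists>m n. (\<phi> ^^ m) (f y) = (\<phi> ^^ n) (f z)" "e \<in> arcs \<Gamma>"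
        "(tail \<Gamma> e, head \<Gamma> e) = (x, y) \<or> (tail \<Gamma> e, head \<Gamma> e) = (y, x)"
      then show "\<exists>m n. (\<phi> ^^ m) (f x) = (\<phi> ^^ n) (f z)"
        using f_arc[of e] merging_trans[where \<phi> = \<phi>] by (metis prod.inject)
    qed auto
    moreover obtain m m' where "(\<phi> ^^ m) (f (g u)) = (\<phi> ^^ 0) u" "(\<phi> ^^ m') (f (g v)) = (\<phi> ^^ 0) v"
      using fg uv by (metis funpow_0)
    ultimately show "\<exists>m n. (\<phi> ^^ m) u = (\<phi> ^^ n) v"
      using merging_trans[where \<phi> = \<phi>] by metis
  qed
  obtain \<psi> C where \<psi>: "\<psi> \<in> V \<rightarrow> V" "merging V \<psi>"
    and per: "\<And>v n. \<lbrakk>v \<in> V; n > 0; (\<psi> ^^ n) v = v\<rbrakk> \<Longrightarrow> \<psi> v = v"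
    and eq: "\<And>v. v \<in> V \<Longrightarrow> \<psi> v = v \<or> \<psi> v = \<phi> v"
    and close: "\<And>v. v \<in> V \<Longrightarrow> \<exists>m n. m + n \<le> C \<and> (\<psi> ^^ m) v = (\<psi> ^^ n) (\<phi> v)"
    using cut_periodic_orbit[OF \<phi> merge] by metis
  have "verts \<Gamma> \<noteq> {}"
    using \<Gamma>(2) unfolding Digraph_Component.connected_def strongly_connected_def by auto
  then have ne: "V \<noteq> {}" using f by auto
  let ?T = "with_proj (parent_graph V \<psi>)"
  note T = wf_parent_graph[of V \<psi>] connected_parent_graph[OF ne \<psi>]
  have iter: "path_dist ?T v ((\<phi> ^^ n) v) \<le> n * C" if v: "v \<in> V" for v n
  proof (induction n)
    case 0
    then show ?case using v by (simp add: path_dist_self)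
  next
    case (Suc n)
    let ?w = "(\<phi> ^^ n) v"
    have w: "?w \<in> V" "\<phi> ?w \<in> V" using funpow_closed[OF \<phi> v] \<phi> by auto
    have "path_dist ?T ?w (\<phi> ?w) \<le> C"
      using close[OF w(1)] path_dist_parent_graph_merge[OF \<psi> w] order_trans by metis
    moreover have "path_dist ?T v (\<phi> ?w) \<le> path_dist ?T v ?w + path_dist ?T ?w (\<phi> ?w)"
      using v w by (intro path_dist_triangle T) auto
    ultimately show ?case using Suc by simp
  qed
  have merge_dist: "path_dist ?T u v \<le> 2 * (k * C)"
    if uv: "u \<in> V" "v \<in> V" and mn: "m \<le> k" "n \<le> k" and e: "(\<phi> ^^ m) u = (\<phi> ^^ n) v" for u v m n
  proof -
    have "path_dist ?T u v \<le> path_dist ?T u ((\<phi> ^^ m) u) + path_dist ?T ((\<phi> ^^ m) u) v"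
      using uv funpow_closed[OF \<phi>] by (intro path_dist_triangle T) auto
    moreover have "path_dist ?T u ((\<phi> ^^ m) u) \<le> k * C"
      using iter[OF uv(1), of m] mult_le_mono1[OF mn(1), of C] by linarith
    moreover have "path_dist ?T ((\<phi> ^^ m) u) v \<le> k * C"
      unfolding e wf_digraph.path_dist_commute[OF T(1), of _ v]
      using iter[OF uv(2), of n] mult_le_mono1[OF mn(2), of C] by linarith
    ultimately show ?thesis by simp
  qed
  define L where "L = max k (2 * (k * C))"
  have "quasi_isometric (graph_metric \<Gamma>) (graph_metric ?T)"
  proof (rule quasi_isometric_if_coarse_inverses[OF \<Gamma> T, where f = f and g = g and k = L])
    fix e assume e: "e \<in> arcs \<Gamma>"
    have "tail \<Gamma> e \<in> verts \<Gamma>" "head \<Gamma> e \<in> verts \<Gamma>"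
      using e wf_digraph.wellformed[OF \<Gamma>(1)] by auto
    then have "path_dist ?T (f (tail \<Gamma> e)) (f (head \<Gamma> e)) \<le> 2 * (k * C)"
      using f_arc[OF e] f merge_dist by blast
    then show "path_dist ?T (f (tail \<Gamma> e)) (f (head \<Gamma> e)) \<le> L"
      by (simp add: L_def)
  next
    fix e assume e: "e \<in> arcs ?T"
    obtain u v where uv: "e = (u, v)" by (cases e)
    have "u \<in> V" "v \<in> V" "u \<noteq> v" "v = \<psi> u \<or> u = \<psi> v"
      using e by (auto simp: uv parent_graph_def)
    then have "u \<in> V" "v \<in> V" "v = \<phi> u \<or> u = \<phi> v"
      using eq by metis+
    then show "path_dist \<Gamma> (g (tail ?T e)) (g (head ?T e)) \<le> L"
      using g_arc wf_digraph.path_dist_commute[OF \<Gamma>(1)]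
      by (auto simp: uv L_def le_max_iff_disj)
  next
    fix v assume "v \<in> verts ?T"
    then have v: "v \<in> V" by simp
    then have "f (g v) \<in> V" using f g by auto
    moreover obtain m where "m \<le> k" "(\<phi> ^^ m) (f (g v)) = (\<phi> ^^ 0) v"
      using fg[OF v] by auto
    ultimately show "path_dist ?T (f (g v)) v \<le> L"
      using merge_dist v by (fastforce simp: L_def le_max_iff_disj)
  qed (use f g gf in \<open>auto simp: L_def le_max_iff_disj\<close>)
  moreover have "undirected_tree (parent_graph V \<psi>)"
    using undirected_tree_parent_graph[OF ne \<psi>] per by metis
  ultimately show ?thesis
    using that by metis
qed

lemma quasi_isometric_nat_tree:
  assumes \<Gamma>: "wf_digraph \<Gamma>" "Digraph_Component.connected \<Gamma>"
    and V: "countable V"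
    and \<phi>: "\<phi> \<in> V \<rightarrow> V"
    and f: "f \<in> verts \<Gamma> \<rightarrow> V"
    and g: "g \<in> V \<rightarrow> verts \<Gamma>"
    and f_arc: "\<And>e. e \<in> arcs \<Gamma> \<Longrightarrow>
      \<exists>m\<le>k. \<exists>n\<le>k. (\<phi> ^^ m) (f (tail \<Gamma> e)) = (\<phi> ^^ n) (f (head \<Gamma> e))"
    and g_arc: "\<And>v. v \<in> V \<Longrightarrow> path_dist \<Gamma> (g v) (g (\<phi> v)) \<le> k"
    and gf: "\<And>x. x \<in> verts \<Gamma> \<Longrightarrow> path_dist \<Gamma> (g (f x)) x \<le> k"
    and fg: "\<And>v. v \<in> V \<Longrightarrow> \<exists>m\<le>k. (\<phi> ^^ m) (f (g v)) = v"
  shows "\<exists>T :: nat pair_pre_digraph. undirected_tree T \<and>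
           quasi_isometric (graph_metric \<Gamma>) (graph_metric (with_proj T))"
proof -
  define c where "c = to_nat_on V"
  define d where "d = inv_into V c"
  have dc: "d (c v) = v" if "v \<in> V" for v
    using that inj_on_to_nat_on[OF V] by (simp add: c_def d_def)
  define \<phi>' where "\<phi>' = c \<circ> \<phi> \<circ> d"
  have iter: "(\<phi>' ^^ n) (c v) = c ((\<phi> ^^ n) v)" if v: "v \<in> V" for v n
    by (induction n) (simp_all add: \<phi>'_def dc funpow_closed[OF \<phi> v])
  have fV: "f x \<in> V" if "x \<in> verts \<Gamma>" for x using f that by auto
  have gV: "g v \<in> verts \<Gamma>" if "v \<in> V" for v using g that by auto
  obtain \<psi> where "undirected_tree (parent_graph (c ` V) \<psi>)"
    "quasi_isometric (graph_metric \<Gamma>) (graph_metric (with_proj (parent_graph (c ` V) \<psi>)))"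
  proof (rule quasi_isometric_parent_graph[OF \<Gamma>, where V = "c ` V" and \<phi> = \<phi>' and k = k
        and f = "c \<circ> f" and g = "g \<circ> d"])
    fix e assume e: "e \<in> arcs \<Gamma>"
    have "tail \<Gamma> e \<in> verts \<Gamma>" "head \<Gamma> e \<in> verts \<Gamma>"
      using e wf_digraph.wellformed[OF \<Gamma>(1)] by auto
    then show "\<exists>m\<le>k. \<exists>n\<le>k. (\<phi>' ^^ m) ((c \<circ> f) (tail \<Gamma> e)) = (\<phi>' ^^ n) ((c \<circ> f) (head \<Gamma> e))"
      using f_arc[OF e] by (metis comp_apply fV iter)
  next
    fix v assume "v \<in> c ` V"
    then obtain w where w: "v = c w" "w \<in> V" by blast
    show "\<exists>m\<le>k. (\<phi>' ^^ m) ((c \<circ> f) ((g \<circ> d) v)) = v"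
      using fg[OF w(2)] by (simp add: w dc iter fV gV) metis
    have "\<phi> w \<in> V" using \<phi> w(2) by blast
    then show "path_dist \<Gamma> ((g \<circ> d) v) ((g \<circ> d) (\<phi>' v)) \<le> k"
      using g_arc[OF w(2)] w by (simp add: \<phi>'_def dc)
  qed (use \<phi> in \<open>auto simp: \<phi>'_def dc fV gV gf\<close>)
  then show ?thesis by blast
qed


section \<open>Prefix replacements\<close>

lemma compact_cantor: "compact (UNIV :: cantor set)"
proof -
  have "compact_space (euclidean :: bool topology)"
    by (simp add: compact_space_def finite_imp_compact)
  then have "compact_space (product_topology (\<lambda>_::nat. euclidean :: bool topology) UNIV)"
    by (simp add: compact_space_product_topology)
  then show ?thesis
    unfolding compact_space_def euclidean_product_topology by simp
qed

lemma conc_suffix: "(\<forall>i<length w. \<kappa> i = w ! i) \<Longrightarrow> w \<frown> suffix (length w) \<kappa> = \<kappa>"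
  by (auto simp: conc_def fun_eq_iff)

lemma open_cylinder: "open (range (\<lambda>\<kappa>. w \<frown> \<kappa>) :: cantor set)"
proof -
  have "range (\<lambda>\<kappa>. w \<frown> \<kappa>) = (\<Inter>i<length w. (\<lambda>\<kappa> :: cantor. \<kappa> i) -` {w ! i})"
  proof (intro equalityI subsetI)
    fix \<kappa> :: cantor
    assume "\<kappa> \<in> (\<Inter>i<length w. (\<lambda>\<kappa>. \<kappa> i) -` {w ! i})"
    then have "w \<frown> suffix (length w) \<kappa> = \<kappa>" by (intro conc_suffix) auto
    then show "\<kappa> \<in> range (\<lambda>\<kappa>. w \<frown> \<kappa>)" by (metis rangeI)
  qed auto
  moreover have "open ((\<lambda>\<kappa> :: cantor. \<kappa> i) -` {w ! i})" for i
    by (intro open_vimage continuous_intros) (simp_all add: open_discrete)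
  ultimately show ?thesis by auto
qed

text \<open>
  The cylinders on which \<open>h\<close> replaces a prefix are open and cover the Cantor space, so finitely many
  of them suffice.
\<close>

lemma prefix_replacing_bounded:
  assumes "prefix_replacing h"
  shows "\<exists>M. \<forall>\<kappa>. \<exists>w u \<kappa>'. length w \<le> M \<and> length u \<le> M \<and> \<kappa> = w \<frown> \<kappa>' \<and>
    (\<forall>\<kappa>''. h (w \<frown> \<kappa>'') = u \<frown> \<kappa>'')"
proof -
  obtain w u where wu: "\<And>\<kappa>. \<kappa> \<in> range (\<lambda>\<kappa>'. w \<kappa> \<frown> \<kappa>')"
    "\<And>\<kappa> \<kappa>'. h (w \<kappa> \<frown> \<kappa>') = u \<kappa> \<frown> \<kappa>'"
    using assms unfolding prefix_replacing_def by metis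
  have "UNIV \<subseteq> (\<Union>\<kappa>. range (\<lambda>\<kappa>'. w \<kappa> \<frown> \<kappa>'))"
    using wu(1) by blast
  then obtain A where A: "finite A" "UNIV \<subseteq> (\<Union>\<kappa>\<in>A. range (\<lambda>\<kappa>'. w \<kappa> \<frown> \<kappa>'))"
    by (rule compactE_image[OF compact_cantor open_cylinder])
  define M where "M = (\<Sum>\<kappa>\<in>A. length (w \<kappa>) + length (u \<kappa>))"
  have M: "length (w \<kappa>) + length (u \<kappa>) \<le> M" if "\<kappa> \<in> A" for \<kappa>
    unfolding M_def using that A(1) by (intro member_le_sum) auto
  show ?thesis
  proof (intro exI[of _ M] allI)
    fix \<kappa>
    obtain \<mu> \<kappa>' where "\<mu> \<in> A" "\<kappa> = w \<mu> \<frown> \<kappa>'" using A(2) by blast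
    then show "\<exists>w u \<kappa>'. length w \<le> M \<and> length u \<le> M \<and> \<kappa> = w \<frown> \<kappa>' \<and>
      (\<forall>\<kappa>''. h (w \<frown> \<kappa>'') = u \<frown> \<kappa>'')"
      using M[of \<mu>] wu(2) by (intro exI[of _ "w \<mu>"] exI[of _ "u \<mu>"] exI[of _ \<kappa>']) auto
  qed
qed


section \<open>The shift graph of an orbit\<close>

locale fg_subgroup_V =
  fixes G S :: "(cantor \<Rightarrow> cantor) set" and \<kappa>\<^sub>0 :: cantor
  assumes subgroup_G: "subgroup G thompson_V"
    and S_subset: "S \<subseteq> G"
    and finite_S: "finite S"
    and generate_S: "generate thompson_V S = G"
begin

abbreviation \<Gamma> where "\<Gamma> \<equiv> orbit_graph G S \<kappa>\<^sub>0"

definition X :: "cantor set" where "X = (\<lambda>g. g \<kappa>\<^sub>0) ` G"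

lemma verts_\<Gamma>: "verts \<Gamma> = X"
  by (simp add: orbit_graph_def action_graph_def X_def)

lemma wf_\<Gamma>: "wf_digraph \<Gamma>"
  by (rule wf_orbit_graph[OF subgroup_G S_subset])

lemma connected_\<Gamma>: "Digraph_Component.connected \<Gamma>"
  by (rule connected_orbit_graph[OF subgroup_G S_subset generate_S])

lemma id_G: "id \<in> G"
  using subgroup.one_closed[OF subgroup_G] by (simp add: thompson_V_def)

lemma comp_G: "g \<in> G \<Longrightarrow> h \<in> G \<Longrightarrow> h \<circ> g \<in> G"
  using subgroup.m_closed[OF subgroup_G, of g h] by (simp add: thompson_V_def)

lemma inverse_G:
  assumes "g \<in> G"
  shows "inv\<^bsub>thompson_V\<^esub> g \<in> G" "(inv\<^bsub>thompson_V\<^esub> g) (g \<kappa>) = \<kappa>" "g ((inv\<^bsub>thompson_V\<^esub> g) \<kappa>) = \<kappa>"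
proof -
  interpret V: group thompson_V by (rule group_thompson_V)
  have g: "g \<in> carrier thompson_V" using assms subgroup.subset[OF subgroup_G] by blast
  show "inv\<^bsub>thompson_V\<^esub> g \<in> G" by (rule subgroup.m_inv_closed[OF subgroup_G assms])
  show "(inv\<^bsub>thompson_V\<^esub> g) (g \<kappa>) = \<kappa>"
    using V.r_inv[OF g] by (simp add: thompson_V_def fun_eq_iff)
  show "g ((inv\<^bsub>thompson_V\<^esub> g) \<kappa>) = \<kappa>"
    using V.l_inv[OF g] by (simp add: thompson_V_def fun_eq_iff)
qed

lemma X_closed: "x \<in> X \<Longrightarrow> g \<in> G \<Longrightarrow> g x \<in> X"
  unfolding X_def
proof (elim imageE)
  fix h assume "x = h \<kappa>\<^sub>0" "h \<in> G" "g \<in> G"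
  then show "g x \<in> (\<lambda>g. g \<kappa>\<^sub>0) ` G"
    using comp_G[of h g] by (intro image_eqI[of _ _ "g \<circ> h"]) simp_all
qed

lemma prefix_replacing_G: "g \<in> G \<Longrightarrow> prefix_replacing g"
  using subgroup.subset[OF subgroup_G] by (auto simp: thompson_V_def)

text \<open>
  The bound is the length of a word in the generators that represents \<open>g\<close>.
\<close>

lemma path_dist_bounded_displacement:
  assumes "g \<in> G"
  shows "\<exists>k. \<forall>x\<in>X. path_dist \<Gamma> x (g x) \<le> k"
proof -
  have arc: "path_dist \<Gamma> x (s x) \<le> 1" if "x \<in> X" "s \<in> S" for x s
    using path_dist_arc_le[OF wf_\<Gamma>, of "(x, s)"] that
    by (simp add: orbit_graph_def action_graph_def X_def)
  have "g \<in> generate thompson_V S" using assms generate_S by simp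
  then show ?thesis
  proof (induction g)
    case one
    then show ?case using path_dist_self[of _ \<Gamma>] by (auto simp: thompson_V_def verts_\<Gamma>)
  next
    case (incl h)
    then show ?case using arc by blast
  next
    case (inv h)
    then have h: "h \<in> G" using S_subset by blast
    have "path_dist \<Gamma> x ((inv\<^bsub>thompson_V\<^esub> h) x) \<le> 1" if "x \<in> X" for x
      using arc[OF X_closed[OF that inverse_G(1)[OF h]] inv] inverse_G(3)[OF h]
        wf_digraph.path_dist_commute[OF wf_\<Gamma>] by metis
    then show ?case by blast
  next
    case (eng g h)
    then obtain k l where k: "\<forall>x\<in>X. path_dist \<Gamma> x (g x) \<le> k" "\<forall>x\<in>X. path_dist \<Gamma> x (h x) \<le> l"
      by blast
    have "path_dist \<Gamma> x (h (g x)) \<le> k + l" if x: "x \<in> X" for x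
    proof -
      have gx: "g x \<in> X" "h (g x) \<in> X" using eng.hyps generate_S x X_closed by auto
      have "path_dist \<Gamma> x (h (g x)) \<le> path_dist \<Gamma> x (g x) + path_dist \<Gamma> (g x) (h (g x))"
        using x gx by (intro path_dist_triangle wf_\<Gamma> connected_\<Gamma>) (auto simp: verts_\<Gamma>)
      then show ?thesis using k x gx by (meson add_mono order_trans)
    qed
    then show ?case by (auto simp: thompson_V_def)
  qed
qed

text \<open>
  A point of the orbit is determined by the word that replaces a prefix of \<open>\<kappa>\<^sub>0\<close> and by the length
  of that prefix.
\<close>

lemma countable_X: "countable X"
proof -
  have "X \<subseteq> range (\<lambda>(u, n). u \<frown> suffix n \<kappa>\<^sub>0)"
  proof
    fix x assume "x \<in> X"
    then obtain g where g: "g \<in> G" "x = g \<kappa>\<^sub>0" by (auto simp: X_def)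
    obtain w u a where wu: "\<kappa>\<^sub>0 = w \<frown> a" "\<And>b. g (w \<frown> b) = u \<frown> b"
      using prefix_replacing_G[OF g(1)] unfolding prefix_replacing_def by blast
    have "a = suffix (length w) \<kappa>\<^sub>0" by (simp add: wu(1) fun_eq_iff)
    then have "x = u \<frown> suffix (length w) \<kappa>\<^sub>0" using g(2) wu by metis
    then show "x \<in> range (\<lambda>(u, n). u \<frown> suffix n \<kappa>\<^sub>0)" by force
  qed
  then show ?thesis by (rule countable_subset) simp
qed

text \<open>
  One group element must work for all tails. This uniformity is what makes lengths of connecting paths
  independent of the tail.
\<close>

definition replaceable :: "bool list \<Rightarrow> bool list \<Rightarrow> bool" where
  "replaceable p q \<longleftrightarrow> (\<exists>g\<in>G. \<forall>\<kappa>. g (p \<frown> \<kappa>) = q \<frown> \<kappa>)"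

lemma replaceable_refl: "replaceable p p"
  unfolding replaceable_def using id_G by (intro bexI[of _ id]) auto

lemma replaceable_sym:
  assumes "replaceable p q"
  shows "replaceable q p"
proof -
  obtain g where g: "g \<in> G" "\<And>\<kappa>. g (p \<frown> \<kappa>) = q \<frown> \<kappa>"
    using assms unfolding replaceable_def by blast
  have "(inv\<^bsub>thompson_V\<^esub> g) (q \<frown> \<kappa>) = p \<frown> \<kappa>" for \<kappa>
    using inverse_G(2)[OF g(1), of "p \<frown> \<kappa>"] unfolding g(2) .
  then show ?thesis unfolding replaceable_def using inverse_G(1)[OF g(1)] by blast
qed

lemma replaceable_trans:
  assumes "replaceable p q" "replaceable q r"
  shows "replaceable p r"
proof -
  obtain g h where "g \<in> G" "\<And>\<kappa>. g (p \<frown> \<kappa>) = q \<frown> \<kappa>" "h \<in> G" "\<And>\<kappa>. h (q \<frown> \<kappa>) = r \<frown> \<kappa>"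
    using assms unfolding replaceable_def by blast
  then show ?thesis
    unfolding replaceable_def by (intro bexI[of _ "h \<circ> g"]) (simp_all add: comp_G)
qed

lemma replaceable_append: "replaceable p q \<Longrightarrow> replaceable (p @ r) (q @ r)"
  unfolding replaceable_def conc_conc[symmetric] by blast

lemma replaceable_X:
  assumes "replaceable p q" "p \<frown> \<kappa> \<in> X"
  shows "q \<frown> \<kappa> \<in> X"
proof -
  obtain g where g: "g \<in> G" "g (p \<frown> \<kappa>) = q \<frown> \<kappa>"
    using assms(1) unfolding replaceable_def by blast
  then show ?thesis using X_closed[OF assms(2) g(1)] by simp
qed

lemma replaceable_path_dist_bounded:
  "\<exists>k. \<forall>p q \<kappa>. length p \<le> n \<and> length q \<le> n \<and> replaceable p q \<and> p \<frown> \<kappa> \<in> X \<longrightarrow>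
    path_dist \<Gamma> (p \<frown> \<kappa>) (q \<frown> \<kappa>) \<le> k"
proof -
  let ?B = "{p :: bool list. length p \<le> n}"
  have fin: "finite ?B"
    using finite_lists_length_le[of "UNIV :: bool set" n] by simp
  have "\<exists>k. \<forall>\<kappa>. replaceable p q \<and> p \<frown> \<kappa> \<in> X \<longrightarrow> path_dist \<Gamma> (p \<frown> \<kappa>) (q \<frown> \<kappa>) \<le> k" for p q
    unfolding replaceable_def using path_dist_bounded_displacement by metis
  then obtain b where b: "\<And>p q \<kappa>. replaceable p q \<Longrightarrow> p \<frown> \<kappa> \<in> X \<Longrightarrow>
      path_dist \<Gamma> (p \<frown> \<kappa>) (q \<frown> \<kappa>) \<le> b p q"
    by metis
  have "b p q \<le> (\<Sum>(p, q)\<in>?B \<times> ?B. b p q)" if "p \<in> ?B" "q \<in> ?B" for p q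
    using member_le_sum[of "(p, q)" "?B \<times> ?B" "\<lambda>(p, q). b p q"] fin that by auto
  then show ?thesis
    using b by (intro exI[of _ "\<Sum>(p, q)\<in>?B \<times> ?B. b p q"]) (blast intro: order_trans)
qed

definition has_short_rep :: "nat \<Rightarrow> bool list \<Rightarrow> bool" where
  "has_short_rep M p \<longleftrightarrow> (\<exists>t. length t \<le> M \<and> replaceable p t)"

definition short_rep :: "nat \<Rightarrow> bool list \<Rightarrow> bool list" where
  "short_rep M p = (SOME t. length t \<le> M \<and> replaceable p t)"

lemma short_rep:
  assumes "has_short_rep M p"
  shows "length (short_rep M p) \<le> M" "replaceable p (short_rep M p)"
  using someI_ex[OF assms[unfolded has_short_rep_def]] by (auto simp: short_rep_def)

lemma has_short_repI: "length p \<le> M \<Longrightarrow> has_short_rep M p"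
  using replaceable_refl by (auto simp: has_short_rep_def)

lemma replaceable_cong:
  assumes "replaceable p q"
  shows "short_rep M p = short_rep M q" "has_short_rep M p = has_short_rep M q"
proof -
  have "replaceable p t \<longleftrightarrow> replaceable q t" for t
    using assms replaceable_sym replaceable_trans by blast
  then show "short_rep M p = short_rep M q" "has_short_rep M p = has_short_rep M q"
    by (simp_all add: short_rep_def has_short_rep_def)
qed

lemma short_rep_idem: "has_short_rep M p \<Longrightarrow> short_rep M (short_rep M p) = short_rep M p"
  by (rule replaceable_cong(1)[OF short_rep(2), symmetric])

text \<open>
  A vertex stands for a class of words together with a tail; the class is encoded by its
  representative, so that replaceable words give the same vertex.
\<close>

definition tree_verts :: "nat \<Rightarrow> (bool list \<times> cantor) set" where
  "tree_verts M = {(p, \<kappa>). length p \<le> M \<and> short_rep M p = p \<and> p \<frown> \<kappa> \<in> X}"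

fun parent :: "nat \<Rightarrow> bool list \<times> cantor \<Rightarrow> bool list \<times> cantor" where
  "parent M (p, \<kappa>) =
     (if has_short_rep M (p @ [\<kappa> 0]) then (short_rep M (p @ [\<kappa> 0]), suffix 1 \<kappa>) else (p, \<kappa>))"

lemma conc_first_letter: "(p @ [\<kappa> 0]) \<frown> suffix 1 \<kappa> = p \<frown> \<kappa>"
proof -
  have "[\<kappa> 0] \<frown> suffix 1 \<kappa> = \<kappa>" by (auto simp: conc_def fun_eq_iff)
  then show ?thesis using conc_conc[of p "[\<kappa> 0]" "suffix 1 \<kappa>"] by simp
qed

lemma parent_closed: "parent M \<in> tree_verts M \<rightarrow> tree_verts M"
proof
  fix v assume v: "v \<in> tree_verts M"
  obtain p \<kappa> where pk: "v = (p, \<kappa>)" by (cases v)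
  show "parent M v \<in> tree_verts M"
    using v short_rep[of M "p @ [\<kappa> 0]"] short_rep_idem replaceable_X[of "p @ [\<kappa> 0]"] conc_first_letter
    by (auto simp: pk tree_verts_def)
qed

text \<open>
  The orbit point \<open>w \<frown> \<kappa>\<close>, started with the empty word, ends after \<open>|w|\<close> parent steps at a vertex
  that depends only on the class of \<open>w\<close> and on \<open>\<kappa>\<close>. No prefix of \<open>w\<close> exceeds the length
  \<open>M\<close>, so the walk does not stop early.
\<close>

lemma funpow_parent:
  assumes "length w \<le> M"
  shows "(parent M ^^ length w) (short_rep M [], w \<frown> \<kappa>) = (short_rep M w, \<kappa>)"
  using assms
proof (induction w arbitrary: \<kappa> rule: rev_induct)
  case (snoc a w)
  have "replaceable (w @ [a]) (short_rep M w @ [a])"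
    using snoc.prems by (intro replaceable_append short_rep has_short_repI) simp
  note cong = replaceable_cong[OF this, of M]
  have a: "([a] \<frown> \<kappa>) 0 = a" "suffix 1 ([a] \<frown> \<kappa>) = \<kappa>"
    by (auto simp: conc_def fun_eq_iff)
  have "(parent M ^^ length (w @ [a])) (short_rep M [], (w @ [a]) \<frown> \<kappa>)
      = parent M ((parent M ^^ length w) (short_rep M [], w \<frown> ([a] \<frown> \<kappa>)))"
    by simp
  also have "\<dots> = parent M (short_rep M w, [a] \<frown> \<kappa>)"
    using snoc.IH[of "[a] \<frown> \<kappa>"] snoc.prems by simp
  also have "\<dots> = (short_rep M (w @ [a]), \<kappa>)"
    using cong has_short_repI[OF snoc.prems] by (simp only: parent.simps a if_True)
  finally show ?case .
qed simp

lemma countable_tree_verts: "countable (tree_verts M)"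
proof -
  have "inj_on (\<lambda>(p, \<kappa>). (p, p \<frown> \<kappa>)) (tree_verts M)"
    by (auto simp: inj_on_def)
  moreover have "countable ((\<lambda>(p, \<kappa>). (p, p \<frown> \<kappa>)) ` tree_verts M)"
    by (rule countable_subset[of _ "UNIV \<times> X"])
      (use countable_X in \<open>auto simp: tree_verts_def\<close>)
  ultimately show ?thesis by (rule countable_image_inj_on[rotated])
qed

lemma orbit_graph_quasi_isometric_tree:
  "\<exists>T :: nat pair_pre_digraph. undirected_tree T \<and>
     quasi_isometric (graph_metric \<Gamma>) (graph_metric (with_proj T))"
proof -
  obtain m where m: "\<And>s \<kappa>. s \<in> S \<Longrightarrow> \<exists>w u \<kappa>'. length w \<le> m s \<and> length u \<le> m s \<and> \<kappa> = w \<frown> \<kappa>' \<and>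
      (\<forall>\<kappa>''. s (w \<frown> \<kappa>'') = u \<frown> \<kappa>'')"
    using prefix_replacing_bounded prefix_replacing_G S_subset by (metis subsetD)
  define M where "M = sum m S"
  have mM: "m s \<le> M" if "s \<in> S" for s
    unfolding M_def using that finite_S by (intro member_le_sum) auto
  \<comment> \<open>The words compared are a representative extended by one letter and a representative, hence \<open>Suc M\<close>.\<close>
  obtain k where k: "\<And>p q \<kappa>. \<lbrakk>length p \<le> Suc M; length q \<le> Suc M; replaceable p q; p \<frown> \<kappa> \<in> X\<rbrakk> \<Longrightarrow>
      path_dist \<Gamma> (p \<frown> \<kappa>) (q \<frown> \<kappa>) \<le> k"
    using replaceable_path_dist_bounded[of "Suc M"] by blast
  define f where "f x = (short_rep M [], x :: cantor)" for x
  define g where "g = (\<lambda>(p, \<kappa>). p \<frown> \<kappa> :: cantor)"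
  have rep0: "length (short_rep M []) \<le> M" "replaceable [] (short_rep M [])"
    "short_rep M (short_rep M []) = short_rep M []"
    using short_rep[OF has_short_repI] short_rep_idem[OF has_short_repI] by auto
  show ?thesis
  proof (rule quasi_isometric_nat_tree[OF wf_\<Gamma> connected_\<Gamma> countable_tree_verts[of M] parent_closed,
        where f = f and g = g and k = "max M k"])
    show "f \<in> verts \<Gamma> \<rightarrow> tree_verts M"
      using rep0 replaceable_X[OF rep0(2)] by (auto simp: f_def tree_verts_def verts_\<Gamma>)
    show "g \<in> tree_verts M \<rightarrow> verts \<Gamma>"
      by (auto simp: g_def tree_verts_def verts_\<Gamma>)
  next
    fix e assume "e \<in> arcs \<Gamma>"
    then obtain x s where e: "e = (x, s)" "s \<in> S"
      by (auto simp: orbit_graph_def action_graph_def)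
    obtain w u \<kappa> where wu: "length w \<le> m s" "length u \<le> m s" "x = w \<frown> \<kappa>"
      "\<forall>\<kappa>''. s (w \<frown> \<kappa>'') = u \<frown> \<kappa>''"
      using m[OF e(2)] by blast
    have le: "length w \<le> M" "length u \<le> M" using wu mM[OF e(2)] by auto
    have "replaceable w u" unfolding replaceable_def using wu(4) e(2) S_subset by blast
    then have "short_rep M w = short_rep M u" by (rule replaceable_cong)
    then have "(parent M ^^ length w) (f x) = (parent M ^^ length u) (f (s x))"
      using funpow_parent[OF le(1)] funpow_parent[OF le(2)] wu by (simp add: f_def)
    moreover have "tail \<Gamma> e = x" "head \<Gamma> e = s x"
      by (simp_all add: e orbit_graph_def action_graph_def)
    ultimately show "\<exists>m\<le>max M k. \<exists>n\<le>max M k.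
        (parent M ^^ m) (f (tail \<Gamma> e)) = (parent M ^^ n) (f (head \<Gamma> e))"
      using le by (metis max.coboundedI1)
  next
    fix v assume v: "v \<in> tree_verts M"
    obtain p \<kappa> where pk: "v = (p, \<kappa>)" by (cases v)
    have p: "length p \<le> M" "short_rep M p = p" "p \<frown> \<kappa> \<in> X" using v by (auto simp: pk tree_verts_def)
    have "(parent M ^^ length p) (f (g v)) = v"
      using funpow_parent[OF p(1)] p(2) by (simp add: f_def g_def pk)
    then show "\<exists>m\<le>max M k. (parent M ^^ m) (f (g v)) = v"
      using p(1) by (metis max.coboundedI1)
    show "path_dist \<Gamma> (g v) (g (parent M v)) \<le> max M k"
    proof (cases "has_short_rep M (p @ [\<kappa> 0])")
      case True
      have "path_dist \<Gamma> ((p @ [\<kappa> 0]) \<frown> suffix 1 \<kappa>) (short_rep M (p @ [\<kappa> 0]) \<frown> suffix 1 \<kappa>) \<le> k"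
        using short_rep[OF True] p by (intro k) (simp_all only: conc_first_letter, auto)
      then show ?thesis
        unfolding conc_first_letter using True by (simp add: g_def pk)
    next
      case False
      then show ?thesis using p by (simp add: g_def pk path_dist_self verts_\<Gamma>)
    qed
  next
    fix x assume "x \<in> verts \<Gamma>"
    then have "path_dist \<Gamma> (short_rep M [] \<frown> x) ([] \<frown> x) \<le> k"
      using rep0 replaceable_sym replaceable_X[OF rep0(2)] by (intro k) (auto simp: verts_\<Gamma>)
    then show "path_dist \<Gamma> (g (f x)) x \<le> max M k"
      by (simp add: f_def g_def)
  qed
qed

end

theorem theoremA:
  fixes G S :: "(cantor \<Rightarrow> cantor) set" and \<kappa>\<^sub>0 :: cantor
  assumes "subgroup G thompson_V"
    and "S \<subseteq> G"
    and "finite S"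
    and "\<forall>s\<in>S. inv\<^bsub>thompson_V\<^esub> s \<in> S"
    and "generate thompson_V S = G"
  shows "\<exists>T :: nat pair_pre_digraph. undirected_tree T \<and>
           quasi_isometric (graph_metric (orbit_graph G S \<kappa>\<^sub>0)) (graph_metric (with_proj T))"
proof -
  interpret fg_subgroup_V G S \<kappa>\<^sub>0
    by (rule fg_subgroup_V.intro[OF assms(1-3,5)])
  show ?thesis by (rule orbit_graph_quasi_isometric_tree)
qed

end
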